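(* For $\theta\in H^\infty$, the map $M_{\theta}:L(H^2)\to L(H^2)$, $M_\theta T=T_\theta T$, satisfies $M_\theta\in L(L(H^2))$ and $\|M_{\theta}\|=\|\theta\|_{\infty}$.
   Context: $\mathbf{D}$ is the open unit disc in $\mathbb{C}$. $H^2$ is the Hardy space of analytic functions $f(z)=\sum_{n\ge 0}a_nz^n$ on $\mathbf{D}$ with $\sum_{n\ge 0}|a_n|^2<\infty$, a Hilbert space with inner product $(f,g)=\sum_n a_n\overline{b_n}$ for $f(z)=\sum a_nz^n$, $g(z)=\sum b_nz^n$. $L(H^2)$ is the Banach space of bounded linear operators on $H^2$ with the operator norm, and $L(L(H^2))$ is the space of bounded linear operators on the Banach space $L(H^2)$, with its operator norm. $H^\infty$ is the Banach space of bounded analytic functions on $\mathbf{D}$ with norm $\|\theta\|_\infty=\sup_{z\in\mathbf{D}}|\theta(z)|$. For $\theta\in H^\infty$, $T_\theta\in L(H^2)$ is given by $(T_\theta f)(z)=\theta(z)f(z)$. *)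

theory Defs
  imports "HOL-Complex_Analysis.Complex_Analysis"
begin

section \<open>Complex normed spaces and the normed space \<open>L(X)\<close>\<close>

text \<open>\<^typ>\<open>'a \<Rightarrow>\<^sub>L 'a\<close> only provides real-linear operators, so complex scalars are added to
  the real normed spaces of the library.\<close>

class complex_normed_vector = real_normed_vector +
  fixes scaleC :: "complex \<Rightarrow> 'a \<Rightarrow> 'a"  (infixr "*\<^sub>C" 75)
  assumes scaleC_add_right: "c *\<^sub>C (x + y) = c *\<^sub>C x + c *\<^sub>C y"
    and scaleC_add_left: "(c + d) *\<^sub>C x = c *\<^sub>C x + d *\<^sub>C x"
    and scaleC_scaleC: "c *\<^sub>C d *\<^sub>C x = (c * d) *\<^sub>C x"
    and scaleR_scaleC: "r *\<^sub>R x = complex_of_real r *\<^sub>C x"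
    and norm_scaleC: "norm (c *\<^sub>C x) = cmod c * norm x"

definition bounded_clinear :: "('a::complex_normed_vector \<Rightarrow> 'b::complex_normed_vector) \<Rightarrow> bool"
  where "bounded_clinear f \<longleftrightarrow> bounded_linear f \<and> (\<forall>c x. f (c *\<^sub>C x) = c *\<^sub>C f x)"

lemma bounded_clinearD:
  assumes "bounded_clinear f"
  shows "bounded_linear f" "f (c *\<^sub>C x) = c *\<^sub>C f x"
  using assms by (auto simp: bounded_clinear_def)

lemma bounded_clinear_zero: "bounded_clinear (\<lambda>x. 0)"
proof -
  have "c *\<^sub>C 0 = (0::'b)" for c
    using scaleC_add_right[of c 0 "0::'b"] by simp
  then show ?thesis by (simp add: bounded_clinear_def)
qed

lemma bounded_clinear_add:
  "bounded_clinear f \<Longrightarrow> bounded_clinear g \<Longrightarrow> bounded_clinear (\<lambda>x. f x + g x)"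
  by (simp add: bounded_clinear_def bounded_linear_add scaleC_add_right)

lemma bounded_clinear_scaleC:
  assumes f: "bounded_clinear f"
  shows "bounded_clinear (\<lambda>x. c *\<^sub>C f x)"
proof -
  interpret f: bounded_linear f using f by (rule bounded_clinearD)
  have "bounded_linear (\<lambda>x. c *\<^sub>C f x)"
  proof (rule bounded_linear_intro[where K = "cmod c * onorm f"])
    show "norm (c *\<^sub>C f x) \<le> norm x * (cmod c * onorm f)" for x
      using mult_left_mono[OF onorm[OF f.bounded_linear, of x], of "cmod c"]
      by (simp add: norm_scaleC mult_ac)
  qed (simp_all add: f.add scaleC_add_right scaleR_scaleC bounded_clinearD(2)[OF f] scaleC_scaleC
      mult.commute)
  then show ?thesis
    using f by (simp add: bounded_clinear_def scaleC_scaleC mult.commute)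
qed

lemma bounded_clinear_scaleR:
  "bounded_clinear f \<Longrightarrow> bounded_clinear (\<lambda>x. r *\<^sub>R f x)"
  unfolding scaleR_scaleC by (rule bounded_clinear_scaleC)

lemma bounded_clinear_minus: "bounded_clinear f \<Longrightarrow> bounded_clinear (\<lambda>x. - f x)"
  using bounded_clinear_scaleR[of f "- 1"] by simp

lemma bounded_clinear_diff:
  "bounded_clinear f \<Longrightarrow> bounded_clinear g \<Longrightarrow> bounded_clinear (\<lambda>x. f x - g x)"
  using bounded_clinear_add[of f "\<lambda>x. - g x"] bounded_clinear_minus[of g] by simp

lemma bounded_clinear_compose:
  "bounded_clinear f \<Longrightarrow> bounded_clinear g \<Longrightarrow> bounded_clinear (\<lambda>x. f (g x))"
  by (simp add: bounded_clinear_def bounded_linear_compose)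

lemma onorm_scaleC_fun:
  fixes f :: "'a::complex_normed_vector \<Rightarrow> 'b::complex_normed_vector"
  assumes f: "bounded_clinear f"
  shows "onorm (\<lambda>x. c *\<^sub>C f x) = cmod c * onorm f"
proof -
  have "onorm (\<lambda>x. c *\<^sub>C f x) = onorm (\<lambda>x. cmod c *\<^sub>R f x)"
    by (simp add: onorm_def norm_scaleC)
  then show ?thesis
    using onorm_scaleR[OF bounded_clinearD(1)[OF f], of "cmod c"] by simp
qed

typedef (overloaded) 'a bop = "{T :: 'a::complex_normed_vector \<Rightarrow> 'a. bounded_clinear T}"
  morphisms bop_apply Bop
  using bounded_clinear_zero by blast

lemma bounded_clinear_bop_apply: "bounded_clinear (bop_apply T)"
  using bop_apply by blast

lemma bop_apply_Bop: "bounded_clinear f \<Longrightarrow> bop_apply (Bop f) = f"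
  by (simp add: Bop_inverse)

lemma bop_eqI: "(\<And>x. bop_apply S x = bop_apply T x) \<Longrightarrow> S = T"
  by (simp add: bop_apply_inject[symmetric] fun_eq_iff)

instantiation bop :: (complex_normed_vector) complex_normed_vector
begin

definition zero_bop :: "'a bop" where "0 = Bop (\<lambda>x. 0)"
definition plus_bop :: "'a bop \<Rightarrow> 'a bop \<Rightarrow> 'a bop"
  where "S + T = Bop (\<lambda>x. bop_apply S x + bop_apply T x)"
definition scaleC_bop :: "complex \<Rightarrow> 'a bop \<Rightarrow> 'a bop"
  where "c *\<^sub>C T = Bop (\<lambda>x. c *\<^sub>C bop_apply T x)"
definition scaleR_bop :: "real \<Rightarrow> 'a bop \<Rightarrow> 'a bop"
  where "r *\<^sub>R T = Bop (\<lambda>x. r *\<^sub>R bop_apply T x)"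
definition uminus_bop :: "'a bop \<Rightarrow> 'a bop" where "- T = (- 1) *\<^sub>R T" for T :: "'a bop"
definition minus_bop :: "'a bop \<Rightarrow> 'a bop \<Rightarrow> 'a bop" where "S - T = S + - T" for S T :: "'a bop"
definition norm_bop :: "'a bop \<Rightarrow> real" where "norm T = onorm (bop_apply T)"
definition dist_bop :: "'a bop \<Rightarrow> 'a bop \<Rightarrow> real" where "dist S T = norm (S - T)" for S T :: "'a bop"
definition sgn_bop :: "'a bop \<Rightarrow> 'a bop" where "sgn T = inverse (norm T) *\<^sub>R T" for T :: "'a bop"
definition uniformity_bop :: "('a bop \<times> 'a bop) filter"
  where "uniformity_bop = (INF e\<in>{0 <..}. principal {(x, y). dist x y < e})"
definition open_bop :: "'a bop set \<Rightarrow> bool"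
  where "open_bop S = (\<forall>x\<in>S. \<forall>\<^sub>F (x', y) in uniformity. x' = x \<longrightarrow> y \<in> S)"

lemma bop_apply_ops:
  "bop_apply 0 x = 0"
  "bop_apply (S + T) x = bop_apply S x + bop_apply T x"
  "bop_apply (c *\<^sub>C T) x = c *\<^sub>C bop_apply T x"
  "bop_apply (r *\<^sub>R T) x = r *\<^sub>R bop_apply T x"
  "bop_apply (- T) x = - bop_apply T x"
  "bop_apply (S - T) x = bop_apply S x - bop_apply T x"
  by (simp_all add: zero_bop_def plus_bop_def scaleC_bop_def scaleR_bop_def uminus_bop_def
      minus_bop_def bop_apply_Bop bounded_clinear_zero bounded_clinear_add bounded_clinear_scaleC
      bounded_clinear_scaleR bounded_clinear_minus bounded_clinear_diff
      bounded_clinear_bop_apply)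

instance
proof
  fix S T U :: "'a bop" and c d :: complex and r s :: real
  note lin = bounded_clinearD(1)[OF bounded_clinear_bop_apply]
  have fun_eqs: "bop_apply (S + T) = (\<lambda>x. bop_apply S x + bop_apply T x)"
    "bop_apply (r *\<^sub>R T) = (\<lambda>x. r *\<^sub>R bop_apply T x)"
    "bop_apply (c *\<^sub>C T) = (\<lambda>x. c *\<^sub>C bop_apply T x)"
    by (simp_all add: fun_eq_iff bop_apply_ops)
  show "S + T + U = S + (T + U)" "S + T = T + S" "0 + T = T" "- T + T = 0" "S - T = S + - T"
    by (rule bop_eqI, simp add: bop_apply_ops)+
  show "r *\<^sub>R (S + T) = r *\<^sub>R S + r *\<^sub>R T" "(r + s) *\<^sub>R T = r *\<^sub>R T + s *\<^sub>R T"
    "r *\<^sub>R s *\<^sub>R T = (r * s) *\<^sub>R T" "1 *\<^sub>R T = T"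
    by (rule bop_eqI, simp add: bop_apply_ops scaleR_add_right scaleR_add_left)+
  show "c *\<^sub>C (S + T) = c *\<^sub>C S + c *\<^sub>C T" "(c + d) *\<^sub>C T = c *\<^sub>C T + d *\<^sub>C T"
    "c *\<^sub>C d *\<^sub>C T = (c * d) *\<^sub>C T" "r *\<^sub>R T = complex_of_real r *\<^sub>C T"
    by (rule bop_eqI, simp add: bop_apply_ops scaleC_add_right scaleC_add_left scaleC_scaleC
        scaleR_scaleC)+
  show "dist S T = norm (S - T)" "sgn T = inverse (norm T) *\<^sub>R T"
    by (simp_all add: dist_bop_def sgn_bop_def)
  show "uniformity = (INF e\<in>{0 <..}. principal {(x :: 'a bop, y). dist x y < e})"
    by (rule uniformity_bop_def)
  show "open X = (\<forall>x\<in>X. \<forall>\<^sub>F (x', y) in uniformity. x' = x \<longrightarrow> y \<in> X)" for X :: "'a bop set"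
    by (rule open_bop_def)
  show "norm T = 0 \<longleftrightarrow> T = 0"
    unfolding norm_bop_def onorm_eq_0[OF lin]
    by (auto simp: bop_apply_ops intro: bop_eqI)
  show "norm (S + T) \<le> norm S + norm T"
    using onorm_triangle[OF lin lin, of S T]
    by (simp add: norm_bop_def fun_eqs)
  show "norm (r *\<^sub>R T) = \<bar>r\<bar> * norm T"
    using onorm_scaleR[OF lin, of r T] by (simp add: norm_bop_def fun_eqs)
  show "norm (c *\<^sub>C T) = cmod c * norm T"
    using onorm_scaleC_fun[OF bounded_clinear_bop_apply, of c T]
    by (simp add: norm_bop_def fun_eqs)
qed

end

definition bop_compose :: "'a::complex_normed_vector bop \<Rightarrow> 'a bop \<Rightarrow> 'a bop"  (infixl "o\<^sub>B" 65)
  where "S o\<^sub>B T = Bop (\<lambda>x. bop_apply S (bop_apply T x))"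

lemma bop_apply_compose: "bop_apply (S o\<^sub>B T) x = bop_apply S (bop_apply T x)"
  by (simp add: bop_compose_def bop_apply_Bop bounded_clinear_compose bounded_clinear_bop_apply)


section \<open>The Hardy space \<open>H\<^sup>2\<close>\<close>

definition taylor_coeff :: "(complex \<Rightarrow> complex) \<Rightarrow> nat \<Rightarrow> complex"
  where "taylor_coeff f n = (deriv ^^ n) f 0 / fact n"

lemma taylor_coeff_sums:
  assumes "f holomorphic_on ball 0 1" "z \<in> ball 0 1"
  shows "(\<lambda>n. taylor_coeff f n * z ^ n) sums f z"
  using holomorphic_power_series[OF assms] by (simp add: taylor_coeff_def)

lemma taylor_coeff_zero: "taylor_coeff (\<lambda>z. 0) n = 0"
  by (simp add: taylor_coeff_def)

lemma taylor_coeff_add: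
  "f holomorphic_on ball 0 1 \<Longrightarrow> g holomorphic_on ball 0 1 \<Longrightarrow>
    taylor_coeff (\<lambda>z. f z + g z) n = taylor_coeff f n + taylor_coeff g n"
  unfolding taylor_coeff_def
  by (subst higher_deriv_add[where S = "ball 0 1"]) (auto simp: add_divide_distrib)

lemma taylor_coeff_cmult:
  "f holomorphic_on ball 0 1 \<Longrightarrow> taylor_coeff (\<lambda>z. c * f z) n = c * taylor_coeff f n"
  unfolding taylor_coeff_def
  by (subst higher_deriv_cmult[where A = "ball 0 1"]) auto

text \<open>Elements of \<open>H\<^sup>2\<close> are functions on the disc; they are represented by their extension by zero
  to the plane, so that equality of elements is equality of functions on the disc.\<close>

typedef h2 = "{f :: complex \<Rightarrow> complex. f holomorphic_on ball 0 1 \<and> (\<forall>z. z \<notin> ball 0 1 \<longrightarrow> f z = 0) \<and>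
    summable (\<lambda>n. (cmod (taylor_coeff f n))\<^sup>2)}"
  morphisms h2_fun H2
proof
  show "(\<lambda>z. 0) \<in> {f :: complex \<Rightarrow> complex. f holomorphic_on ball 0 1 \<and>
      (\<forall>z. z \<notin> ball 0 1 \<longrightarrow> f z = 0) \<and> summable (\<lambda>n. (cmod (taylor_coeff f n))\<^sup>2)}"
    by (simp add: taylor_coeff_zero)
qed

abbreviation h2_coeff :: "h2 \<Rightarrow> nat \<Rightarrow> complex"
  where "h2_coeff f \<equiv> taylor_coeff (h2_fun f)"

lemma h2_fun_holomorphic: "h2_fun f holomorphic_on ball 0 1"
  and h2_fun_outside: "z \<notin> ball 0 1 \<Longrightarrow> h2_fun f z = 0"
  and h2_summable: "summable (\<lambda>n. (cmod (h2_coeff f n))\<^sup>2)"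
  using h2_fun[of f] by auto

lemma h2_eqI: "(\<And>z. h2_fun f z = h2_fun g z) \<Longrightarrow> f = g"
  by (simp add: h2_fun_inject[symmetric] fun_eq_iff)

definition h2_inner :: "h2 \<Rightarrow> h2 \<Rightarrow> complex"
  where "h2_inner f g = (\<Sum>n. h2_coeff f n * cnj (h2_coeff g n))"

lemma summable_cmod_add_sq:
  fixes a b :: "nat \<Rightarrow> complex"
  assumes "summable (\<lambda>n. (cmod (a n))\<^sup>2)" "summable (\<lambda>n. (cmod (b n))\<^sup>2)"
  shows "summable (\<lambda>n. (cmod (a n + b n))\<^sup>2)"
proof (rule summable_comparison_test'[where N = 0])
  show "summable (\<lambda>n. 2 * (cmod (a n))\<^sup>2 + 2 * (cmod (b n))\<^sup>2)"
    using assms by (intro summable_add summable_mult)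
  fix n
  have "(cmod (a n + b n))\<^sup>2 \<le> (cmod (a n) + cmod (b n))\<^sup>2"
    by (intro power_mono norm_triangle_ineq) simp
  also have "\<dots> \<le> 2 * (cmod (a n))\<^sup>2 + 2 * (cmod (b n))\<^sup>2"
    using sum_squares_bound[of "cmod (a n)" "cmod (b n)"] by (simp add: power2_sum)
  finally show "norm ((cmod (a n + b n))\<^sup>2) \<le> 2 * (cmod (a n))\<^sup>2 + 2 * (cmod (b n))\<^sup>2" by simp
qed

lemma h2_inner_summable: "summable (\<lambda>n. h2_coeff f n * cnj (h2_coeff g n))"
proof (rule summable_comparison_test'[where N = 0])
  show "summable (\<lambda>n. (cmod (h2_coeff f n))\<^sup>2 + (cmod (h2_coeff g n))\<^sup>2)"
    by (intro summable_add h2_summable)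
  fix n
  have "2 * (cmod (h2_coeff f n) * cmod (h2_coeff g n))
      \<le> (cmod (h2_coeff f n))\<^sup>2 + (cmod (h2_coeff g n))\<^sup>2"
    using sum_squares_bound[of "cmod (h2_coeff f n)" "cmod (h2_coeff g n)"] by simp
  moreover have "0 \<le> cmod (h2_coeff f n) * cmod (h2_coeff g n)" by simp
  ultimately show "norm (h2_coeff f n * cnj (h2_coeff g n))
      \<le> (cmod (h2_coeff f n))\<^sup>2 + (cmod (h2_coeff g n))\<^sup>2"
    unfolding norm_mult complex_mod_cnj by linarith
qed

instantiation h2 :: complex_normed_vector
begin

definition zero_h2 :: h2 where "0 = H2 (\<lambda>z. 0)"
definition plus_h2 :: "h2 \<Rightarrow> h2 \<Rightarrow> h2" where "f + g = H2 (\<lambda>z. h2_fun f z + h2_fun g z)"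
definition scaleC_h2 :: "complex \<Rightarrow> h2 \<Rightarrow> h2" where "c *\<^sub>C f = H2 (\<lambda>z. c * h2_fun f z)"
definition scaleR_h2 :: "real \<Rightarrow> h2 \<Rightarrow> h2" where "r *\<^sub>R f = complex_of_real r *\<^sub>C f" for f :: h2
definition uminus_h2 :: "h2 \<Rightarrow> h2" where "- f = (- 1) *\<^sub>C f" for f :: h2
definition minus_h2 :: "h2 \<Rightarrow> h2 \<Rightarrow> h2" where "f - g = f + - g" for f g :: h2
definition norm_h2 :: "h2 \<Rightarrow> real" where "norm f = sqrt (Re (h2_inner f f))"
definition dist_h2 :: "h2 \<Rightarrow> h2 \<Rightarrow> real" where "dist f g = norm (f - g)" for f g :: h2
definition sgn_h2 :: "h2 \<Rightarrow> h2" where "sgn f = inverse (norm f) *\<^sub>R f" for f :: h2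
definition uniformity_h2 :: "(h2 \<times> h2) filter"
  where "uniformity_h2 = (INF e\<in>{0 <..}. principal {(x, y). dist x y < e})"
definition open_h2 :: "h2 set \<Rightarrow> bool"
  where "open_h2 S = (\<forall>x\<in>S. \<forall>\<^sub>F (x', y) in uniformity. x' = x \<longrightarrow> y \<in> S)"

lemma h2_fun_zero: "h2_fun 0 z = 0"
  by (simp add: zero_h2_def H2_inverse taylor_coeff_zero)

lemma h2_fun_add: "h2_fun (f + g) z = h2_fun f z + h2_fun g z"
proof -
  have "(\<lambda>z. h2_fun f z + h2_fun g z) holomorphic_on ball 0 1"
    by (intro holomorphic_intros h2_fun_holomorphic)
  moreover have "summable (\<lambda>n. (cmod (taylor_coeff (\<lambda>z. h2_fun f z + h2_fun g z) n))\<^sup>2)"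
    by (simp add: taylor_coeff_add h2_fun_holomorphic summable_cmod_add_sq h2_summable)
  ultimately show ?thesis
    by (simp add: plus_h2_def H2_inverse h2_fun_outside)
qed

lemma h2_fun_scaleC: "h2_fun (c *\<^sub>C f) z = c * h2_fun f z"
proof -
  have "(\<lambda>z. c * h2_fun f z) holomorphic_on ball 0 1"
    by (intro holomorphic_intros h2_fun_holomorphic)
  moreover have "summable (\<lambda>n. (cmod (taylor_coeff (\<lambda>z. c * h2_fun f z) n))\<^sup>2)"
    by (simp add: taylor_coeff_cmult h2_fun_holomorphic norm_mult power_mult_distrib
        summable_mult h2_summable)
  ultimately show ?thesis
    by (simp add: scaleC_h2_def H2_inverse h2_fun_outside)
qed

lemmas h2_fun_ops = h2_fun_zero h2_fun_add h2_fun_scaleC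

lemma h2_coeff_add: "h2_coeff (f + g) n = h2_coeff f n + h2_coeff g n"
proof -
  have "h2_fun (f + g) = (\<lambda>z. h2_fun f z + h2_fun g z)" by (simp add: fun_eq_iff h2_fun_add)
  then show ?thesis by (simp only: taylor_coeff_add h2_fun_holomorphic)
qed

lemma h2_coeff_scaleC: "h2_coeff (c *\<^sub>C f) n = c * h2_coeff f n"
proof -
  have "h2_fun (c *\<^sub>C f) = (\<lambda>z. c * h2_fun f z)" by (simp add: fun_eq_iff h2_fun_scaleC)
  then show ?thesis by (simp only: taylor_coeff_cmult h2_fun_holomorphic)
qed

lemma h2_inner_self: "h2_inner f f = of_real (\<Sum>n. (cmod (h2_coeff f n))\<^sup>2)"
proof -
  have "(\<lambda>n. complex_of_real ((cmod (h2_coeff f n))\<^sup>2)) sums of_real (\<Sum>n. (cmod (h2_coeff f n))\<^sup>2)"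
    using h2_summable by (intro sums_of_real summable_sums)
  then show ?thesis
    unfolding h2_inner_def complex_norm_square by (rule sums_unique[symmetric])
qed

lemma norm_h2_eq: "norm f = sqrt (\<Sum>n. (cmod (h2_coeff f n))\<^sup>2)" for f :: h2
  by (simp add: norm_h2_def h2_inner_self)

lemma norm_h2_power2: "(norm f)\<^sup>2 = (\<Sum>n. (cmod (h2_coeff f n))\<^sup>2)" for f :: h2
  by (simp add: norm_h2_eq suminf_nonneg h2_summable)

lemma norm_h2_triangle: "norm (f + g) \<le> norm f + norm g" for f g :: h2
proof -
  have fin: "L2_set (\<lambda>n. cmod (h2_coeff k n)) {..<N} \<le> norm k" for k N
    unfolding norm_h2_eq L2_set_def
    by (intro real_sqrt_le_mono sum_le_suminf h2_summable) auto
  have "(\<Sum>n<N. (cmod (h2_coeff (f + g) n))\<^sup>2) \<le> (norm f + norm g)\<^sup>2" for N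
  proof -
    have "L2_set (\<lambda>n. cmod (h2_coeff (f + g) n)) {..<N}
        \<le> L2_set (\<lambda>n. cmod (h2_coeff f n) + cmod (h2_coeff g n)) {..<N}"
      by (intro L2_set_mono) (auto simp: h2_coeff_add norm_triangle_ineq)
    also have "\<dots> \<le> L2_set (\<lambda>n. cmod (h2_coeff f n)) {..<N} + L2_set (\<lambda>n. cmod (h2_coeff g n)) {..<N}"
      by (rule L2_set_triangle_ineq)
    also have "\<dots> \<le> norm f + norm g"
      by (rule add_mono[OF fin[of f] fin[of g]])
    finally show ?thesis
      unfolding L2_set_def by (rule sqrt_le_D)
  qed
  then have "(norm (f + g))\<^sup>2 \<le> (norm f + norm g)\<^sup>2"
    unfolding norm_h2_power2[of "f + g"] by (rule suminf_le_const[OF h2_summable])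
  moreover have "0 \<le> norm k" for k :: h2
    by (simp add: norm_h2_eq suminf_nonneg h2_summable)
  ultimately show ?thesis
    by (meson add_nonneg_nonneg power2_le_imp_le)
qed

lemma norm_h2_scaleC: "norm (c *\<^sub>C f) = cmod c * norm f" for f :: h2
  by (simp add: norm_h2_eq h2_coeff_scaleC norm_mult power_mult_distrib suminf_mult h2_summable
      real_sqrt_mult)

instance
proof
  fix f g h :: h2 and c d :: complex and r s :: real
  show "f + g + h = f + (g + h)" "f + g = g + f" "0 + f = f" "- f + f = 0" "f - g = f + - g"
    by (rule h2_eqI, simp add: h2_fun_ops uminus_h2_def minus_h2_def)+
  show "c *\<^sub>C (f + g) = c *\<^sub>C f + c *\<^sub>C g" "(c + d) *\<^sub>C f = c *\<^sub>C f + d *\<^sub>C f"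
    "c *\<^sub>C d *\<^sub>C f = (c * d) *\<^sub>C f" "r *\<^sub>R f = complex_of_real r *\<^sub>C f"
    by (rule h2_eqI, simp add: h2_fun_ops scaleR_h2_def algebra_simps)+
  show "r *\<^sub>R (f + g) = r *\<^sub>R f + r *\<^sub>R g" "(r + s) *\<^sub>R f = r *\<^sub>R f + s *\<^sub>R f"
    "r *\<^sub>R s *\<^sub>R f = (r * s) *\<^sub>R f" "1 *\<^sub>R f = f"
    by (rule h2_eqI, simp add: h2_fun_ops scaleR_h2_def algebra_simps)+
  show "dist f g = norm (f - g)" "sgn f = inverse (norm f) *\<^sub>R f"
    by (simp_all add: dist_h2_def sgn_h2_def)
  show "uniformity = (INF e\<in>{0 <..}. principal {(x :: h2, y). dist x y < e})"
    by (rule uniformity_h2_def)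
  show "open X = (\<forall>x\<in>X. \<forall>\<^sub>F (x', y) in uniformity. x' = x \<longrightarrow> y \<in> X)" for X :: "h2 set"
    by (rule open_h2_def)
  show "norm f = 0 \<longleftrightarrow> f = 0"
  proof
    assume "norm f = 0"
    then have "\<forall>n. (cmod (h2_coeff f n))\<^sup>2 = 0"
      using suminf_eq_zero_iff[OF h2_summable[of f]] by (simp add: norm_h2_eq)
    then have coeff: "h2_coeff f n = 0" for n by simp
    show "f = 0"
    proof (rule h2_eqI)
      fix z
      show "h2_fun f z = h2_fun 0 z"
      proof (cases "z \<in> ball 0 1")
        case True
        from taylor_coeff_sums[OF h2_fun_holomorphic this, of f] show ?thesis
          by (simp add: coeff h2_fun_zero sums_iff)
      qed (simp add: h2_fun_outside)
    qed
  next
    assume "f = 0"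
    moreover have "h2_fun 0 = (\<lambda>z. 0)" by (simp add: fun_eq_iff h2_fun_zero)
    ultimately show "norm f = 0" by (simp add: norm_h2_eq taylor_coeff_zero)
  qed
  show "norm (f + g) \<le> norm f + norm g" by (rule norm_h2_triangle)
  show "norm (c *\<^sub>C f) = cmod c * norm f" by (rule norm_h2_scaleC)
  show "norm (r *\<^sub>R f) = \<bar>r\<bar> * norm f" by (simp add: scaleR_h2_def norm_h2_scaleC)
qed

end


section \<open>\<open>H\<^sup>\<infinity>\<close> and multiplication operators\<close>

text \<open>The values of a member of \<open>Hinf\<close> off the disc are unconstrained; \<open>hinf_norm\<close> and \<open>T_op\<close>
  below do not depend on them.\<close>

definition Hinf :: "(complex \<Rightarrow> complex) set"
  where "Hinf = {\<theta>. \<theta> holomorphic_on ball 0 1 \<and> bounded (\<theta> ` ball 0 1)}"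

definition hinf_norm :: "(complex \<Rightarrow> complex) \<Rightarrow> real"
  where "hinf_norm \<theta> = (SUP z\<in>ball 0 1. cmod (\<theta> z))"

text \<open>For \<open>\<theta> \<in> Hinf\<close> the arguments of \<^term>\<open>H2\<close> and \<^term>\<open>Bop\<close> in \<open>T_op\<close> lie in the
  defining sets of the two types; see \<open>h2_fun_T_op\<close>.\<close>

definition T_op :: "(complex \<Rightarrow> complex) \<Rightarrow> h2 bop"
  where "T_op \<theta> = Bop (\<lambda>f. H2 (\<lambda>z. \<theta> z * h2_fun f z))"

definition M_op :: "(complex \<Rightarrow> complex) \<Rightarrow> h2 bop \<Rightarrow> h2 bop"
  where "M_op \<theta> T = T_op \<theta> o\<^sub>B T"

lemma integral_cis_int:
  "((\<lambda>t. cis (of_int k * t)) has_integral (if k = 0 then of_real (2 * pi) else 0)) {0..2*pi}"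
proof (cases "k = 0")
  case True
  have "((\<lambda>t::real. 1::complex) has_integral of_real (2 * pi)) {0..2*pi}"
    using has_integral_const_real[of "1::complex" 0 "2*pi"] by (simp add: scaleR_conv_of_real)
  with True show ?thesis by simp
next
  case False
  define c where "c = \<i> * complex_of_int k"
  have c: "c \<noteq> 0" using False by (simp add: c_def)
  have cis: "cis (of_int k * t) = exp (c * of_real t)" for t
    unfolding cis_conv_exp c_def by (simp only: of_real_mult of_real_of_int_eq mult.assoc)
  have "((\<lambda>t. exp (c * of_real t) / c) has_vector_derivative exp (c * of_real t))
      (at t within {0..2*pi})" for t
  proof (rule has_vector_derivative_real_field)
    show "((\<lambda>z. exp (c * z) / c) has_field_derivative exp (c * of_real t)) (at (of_real t))"
      using c by (auto intro!: derivative_eq_intros)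
  qed
  then have "((\<lambda>t. exp (c * of_real t)) has_integral
      (exp (c * of_real (2*pi)) / c - exp (c * of_real 0) / c)) {0..2*pi}"
    by (intro fundamental_theorem_of_calculus) auto
  moreover have "exp (c * of_real (2*pi)) = 1"
    using cis[of "2*pi"] cis_multiple_2pi[of "of_int k"] by (simp add: mult.commute)
  ultimately show ?thesis
    unfolding cis using False by simp
qed

lemma integral_poly_circle:
  fixes a :: "nat \<Rightarrow> complex"
  shows "((\<lambda>t. (cmod (\<Sum>n<N. a n * (of_real r * cis t) ^ n))\<^sup>2) has_integral
      2 * pi * (\<Sum>n<N. (cmod (a n))\<^sup>2 * r ^ (2 * n))) {0..2*pi}"
proof -
  define c where "c = (\<lambda>n m. a n * cnj (a m) * of_real (r ^ (n + m)))"
  have c_diag: "c n n = of_real ((cmod (a n))\<^sup>2 * r ^ (2 * n))" for n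
    unfolding of_real_mult complex_norm_square c_def mult_2 ..
  have 1: "complex_of_real ((cmod (\<Sum>n<N. a n * (of_real r * cis t) ^ n))\<^sup>2)
      = (\<Sum>n<N. \<Sum>m<N. c n m * cis (of_int (int n - int m) * t))" for t
  proof -
    have cis: "cis (of_int (int n - int m) * t) = cis t ^ n * cnj (cis t) ^ m" for n m
      by (simp only: Complex.DeMoivre cis_cnj cis_mult left_diff_distrib) (simp add: algebra_simps)
    show ?thesis
      unfolding complex_norm_square cnj_sum sum_product cis
      by (intro sum.cong refl) (simp add: c_def power_mult_distrib power_add mult_ac)
  qed
  have "((\<lambda>t. \<Sum>n<N. \<Sum>m<N. c n m * cis (of_int (int n - int m) * t)) has_integral
      (\<Sum>n<N. \<Sum>m<N. c n m * (if int n - int m = 0 then of_real (2 * pi) else 0))) {0..2*pi}"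
    by (intro has_integral_sum has_integral_mult_right integral_cis_int) auto
  also have "(\<Sum>n<N. \<Sum>m<N. c n m * (if int n - int m = 0 then of_real (2 * pi) else 0))
      = (\<Sum>n<N. \<Sum>m<N. if n = m then c n m * of_real (2 * pi) else 0)"
    by (intro sum.cong) auto
  also have "\<dots> = of_real (2 * pi * (\<Sum>n<N. (cmod (a n))\<^sup>2 * r ^ (2 * n)))"
    by (simp add: c_diag sum_distrib_left mult_ac)
  finally have "((\<lambda>t. complex_of_real ((cmod (\<Sum>n<N. a n * (of_real r * cis t) ^ n))\<^sup>2)) has_integral
      of_real (2 * pi * (\<Sum>n<N. (cmod (a n))\<^sup>2 * r ^ (2 * n)))) {0..2*pi}"
    unfolding 1 .
  from has_integral_Re[OF this] show ?thesis by simp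
qed

lemma parseval_circle:
  assumes f: "f holomorphic_on ball 0 1" and r: "0 < r" "r < 1"
  shows "(\<lambda>n. 2 * pi * ((cmod (taylor_coeff f n))\<^sup>2 * r ^ (2 * n))) sums
      integral {0..2*pi} (\<lambda>t. (cmod (f (of_real r * cis t)))\<^sup>2)"
proof -
  define S where "S = (\<lambda>N z. \<Sum>n<N. taylor_coeff f n * z ^ n)"
  have circ: "of_real r * cis t \<in> cball 0 r" for t using r by (simp add: norm_mult)
  obtain s where s: "r < s" "s < 1" using r dense by blast
  have "summable (\<lambda>n. taylor_coeff f n * of_real s ^ n)"
    using taylor_coeff_sums[OF f, of "of_real s"] s r by (simp add: sums_iff)
  then have "ereal s \<le> conv_radius (taylor_coeff f)"
    using conv_radius_geI[of "taylor_coeff f" "of_real s"] s r by simp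
  then have "ereal r < conv_radius (taylor_coeff f)"
    using s(1) by (meson ereal_less_eq less_ereal.simps(1) less_le_trans)
  then have "uniform_limit (cball 0 r) (\<lambda>N z. \<Sum>n<N. taylor_coeff f n * (z - 0) ^ n)
      (\<lambda>z. \<Sum>n. taylor_coeff f n * (z - 0) ^ n) sequentially"
    by (rule powser_uniform_limit)
  then have unif: "uniform_limit (cball 0 r) S f sequentially"
    by (rule uniform_limit_cong'[THEN iffD1, rotated -1])
      (use r taylor_coeff_sums[OF f] in \<open>auto simp: S_def sums_iff\<close>)
  have unif_circ: "uniform_limit {0..2*pi} (\<lambda>N t. cmod (S N (of_real r * cis t)))
      (\<lambda>t. cmod (f (of_real r * cis t))) sequentially"
    by (intro uniform_limit_norm uniform_limit_compose'[OF unif]) (use circ in auto)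
  have "continuous_on (cball 0 r) f"
    using r by (intro holomorphic_on_imp_continuous_on holomorphic_on_subset[OF f]) auto
  then have "bounded (f ` cball 0 r)"
    by (intro compact_imp_bounded compact_continuous_image compact_cball)
  then obtain B where B: "cmod (f z) \<le> B" if "z \<in> cball 0 r" for z
    unfolding bounded_iff by (meson imageI)
  have bd: "bounded ((\<lambda>t. cmod (f (of_real r * cis t))) ` {0..2*pi})"
    unfolding bounded_iff using B[OF circ] by auto
  have unif2: "uniform_limit {0..2*pi} (\<lambda>N t. (cmod (S N (of_real r * cis t)))\<^sup>2)
      (\<lambda>t. (cmod (f (of_real r * cis t)))\<^sup>2) sequentially"
    unfolding power2_eq_square by (rule uniform_lim_mult[OF unif_circ unif_circ bd bd])
  have cont: "continuous_on {0..2*pi} (\<lambda>t. (cmod (S N (of_real r * cis t)))\<^sup>2)" for N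
    unfolding S_def by (intro continuous_intros)
  obtain I J where I: "\<And>N. ((\<lambda>t. (cmod (S N (of_real r * cis t)))\<^sup>2) has_integral I N) {0..2*pi}"
    and J: "((\<lambda>t. (cmod (f (of_real r * cis t)))\<^sup>2) has_integral J) {0..2*pi}"
    and lim: "I \<longlonglongrightarrow> J"
    by (rule uniform_limit_integral[OF unif2 cont]) auto
  have "I N = (\<Sum>n<N. 2 * pi * ((cmod (taylor_coeff f n))\<^sup>2 * r ^ (2 * n)))" for N
    using has_integral_unique[OF I[of N, unfolded S_def] integral_poly_circle]
    by (simp only: sum_distrib_left)
  then have "I = (\<lambda>N. \<Sum>n<N. 2 * pi * ((cmod (taylor_coeff f n))\<^sup>2 * r ^ (2 * n)))"
    by (rule ext)
  then show ?thesis
    using lim unfolding sums_def integral_unique[OF J] by simp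
qed

lemma continuous_circle:
  assumes "f holomorphic_on ball 0 1" "0 < r" "r < 1"
  shows "continuous_on {0..2*pi} (\<lambda>t. (cmod (f (of_real r * cis t)))\<^sup>2)"
  using assms
  by (intro continuous_intros continuous_on_compose2[OF holomorphic_on_imp_continuous_on[OF assms(1)]])
    (auto simp: norm_mult)

lemma mult_coeff_sum_le:
  assumes th: "\<theta> holomorphic_on ball 0 1" and C: "\<And>z. z \<in> ball 0 1 \<Longrightarrow> cmod (\<theta> z) \<le> C"
  shows "(\<Sum>n<N. (cmod (taylor_coeff (\<lambda>z. \<theta> z * h2_fun f z) n))\<^sup>2) \<le> (C * norm f)\<^sup>2"
proof -
  define g where "g = (\<lambda>z. \<theta> z * h2_fun f z)"
  have g: "g holomorphic_on ball 0 1"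
    unfolding g_def by (intro holomorphic_intros th h2_fun_holomorphic)
  have le: "(\<Sum>n<N. (cmod (taylor_coeff g n))\<^sup>2 * r ^ (2 * n)) \<le> (C * norm f)\<^sup>2"
    if r: "0 < r" "r < 1" for r
  proof -
    note pg = parseval_circle[OF g r] and pf = parseval_circle[OF h2_fun_holomorphic[of f] r]
    have "2 * pi * (\<Sum>n<N. (cmod (taylor_coeff g n))\<^sup>2 * r ^ (2 * n))
        = (\<Sum>n<N. 2 * pi * ((cmod (taylor_coeff g n))\<^sup>2 * r ^ (2 * n)))"
      by (simp add: sum_distrib_left)
    also have "\<dots> \<le> integral {0..2*pi} (\<lambda>t. (cmod (g (of_real r * cis t)))\<^sup>2)"
      using pg r by (subst sums_unique[OF pg], intro sum_le_suminf) (auto simp: sums_iff)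
    also have "\<dots> \<le> integral {0..2*pi} (\<lambda>t. C\<^sup>2 * (cmod (h2_fun f (of_real r * cis t)))\<^sup>2)"
    proof (rule integral_le)
      fix t
      have "cmod (\<theta> (of_real r * cis t)) \<le> C" using r by (intro C) (simp add: norm_mult)
      then show "(cmod (g (of_real r * cis t)))\<^sup>2 \<le> C\<^sup>2 * (cmod (h2_fun f (of_real r * cis t)))\<^sup>2"
        unfolding g_def norm_mult power_mult_distrib
        by (intro mult_right_mono power_mono) auto
    qed (intro integrable_continuous_real continuous_intros continuous_circle g
        h2_fun_holomorphic r)+
    also have "\<dots> = C\<^sup>2 * (\<Sum>n. 2 * pi * ((cmod (h2_coeff f n))\<^sup>2 * r ^ (2 * n)))"
      using sums_unique[OF pf] by simp
    also have "\<dots> \<le> C\<^sup>2 * (\<Sum>n. 2 * pi * (cmod (h2_coeff f n))\<^sup>2)"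
      using pf r
      by (intro mult_left_mono suminf_le summable_mult h2_summable mult_left_le power_le_one)
        (auto simp: sums_iff)
    also have "\<dots> = 2 * pi * (C * norm f)\<^sup>2"
      by (simp add: suminf_mult h2_summable norm_h2_power2 power_mult_distrib)
    finally show ?thesis by simp
  qed
  have "((\<lambda>r. \<Sum>n<N. (cmod (taylor_coeff g n))\<^sup>2 * r ^ (2 * n)) \<longlongrightarrow>
      (\<Sum>n<N. (cmod (taylor_coeff g n))\<^sup>2 * 1 ^ (2 * n))) (at_left (1::real))"
    by (intro tendsto_intros)
  moreover have "\<forall>\<^sub>F r in at_left (1::real).
      (\<Sum>n<N. (cmod (taylor_coeff g n))\<^sup>2 * r ^ (2 * n)) \<le> (C * norm f)\<^sup>2"
    using eventually_at_left_real[of 0 1] by (auto elim!: eventually_mono intro: le)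
  ultimately show ?thesis
    unfolding g_def[symmetric] by (auto dest: tendsto_upperbound)
qed

lemma
  assumes "\<theta> \<in> Hinf"
  shows h2_fun_mult: "h2_fun (H2 (\<lambda>z. \<theta> z * h2_fun f z)) = (\<lambda>z. \<theta> z * h2_fun f z)"
    and bounded_clinear_mult: "bounded_clinear (\<lambda>f. H2 (\<lambda>z. \<theta> z * h2_fun f z))"
    and h2_fun_T_op: "h2_fun (bop_apply (T_op \<theta>) f) z = \<theta> z * h2_fun f z"
proof -
  from assms have th: "\<theta> holomorphic_on ball 0 1" and "bounded (\<theta> ` ball 0 1)"
    by (auto simp: Hinf_def)
  then obtain C where C: "\<And>z. z \<in> ball 0 1 \<Longrightarrow> cmod (\<theta> z) \<le> C"
    unfolding bounded_iff by blast
  have C0: "0 \<le> C" using C[of 0] by (simp add: order_trans[OF norm_ge_zero])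
  note le = mult_coeff_sum_le[OF th C]
  have sm: "summable (\<lambda>n. (cmod (taylor_coeff (\<lambda>z. \<theta> z * h2_fun f z) n))\<^sup>2)" for f
    by (rule summableI_nonneg_bounded[OF _ le]) auto
  have fn: "h2_fun (H2 (\<lambda>z. \<theta> z * h2_fun f z)) = (\<lambda>z. \<theta> z * h2_fun f z)" for f
  proof (rule H2_inverse, intro CollectI conjI allI impI)
    show "(\<lambda>z. \<theta> z * h2_fun f z) holomorphic_on ball 0 1"
      by (intro holomorphic_intros th h2_fun_holomorphic)
  qed (simp_all add: sm h2_fun_outside)
  then show "h2_fun (H2 (\<lambda>z. \<theta> z * h2_fun f z)) = (\<lambda>z. \<theta> z * h2_fun f z)" .
  have bd: "norm (H2 (\<lambda>z. \<theta> z * h2_fun f z)) \<le> norm f * C" for f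
  proof (rule power2_le_imp_le)
    show "(norm (H2 (\<lambda>z. \<theta> z * h2_fun f z)))\<^sup>2 \<le> (norm f * C)\<^sup>2"
      unfolding norm_h2_power2 fn mult.commute[of "norm f"]
      by (rule suminf_le_const[OF sm le])
  qed (use C0 in simp)
  show bcl: "bounded_clinear (\<lambda>f. H2 (\<lambda>z. \<theta> z * h2_fun f z))"
    unfolding bounded_clinear_def
  proof (intro conjI allI bounded_linear_intro[OF _ _ bd])
    fix f g :: h2 and c :: complex and r :: real
    show "H2 (\<lambda>z. \<theta> z * h2_fun (f + g) z)
        = H2 (\<lambda>z. \<theta> z * h2_fun f z) + H2 (\<lambda>z. \<theta> z * h2_fun g z)"
      "H2 (\<lambda>z. \<theta> z * h2_fun (r *\<^sub>R f) z) = r *\<^sub>R H2 (\<lambda>z. \<theta> z * h2_fun f z)"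
      "H2 (\<lambda>z. \<theta> z * h2_fun (c *\<^sub>C f) z) = c *\<^sub>C H2 (\<lambda>z. \<theta> z * h2_fun f z)"
      by (rule h2_eqI, simp only: fn scaleR_scaleC, simp only: fn h2_fun_ops,
          simp add: algebra_simps)+
  qed
  show "h2_fun (bop_apply (T_op \<theta>) f) z = \<theta> z * h2_fun f z"
    by (simp add: T_op_def bop_apply_Bop bcl fn)
qed

end

theory Submission
  imports Defs
begin

text \<open>Left multiplication by an operator \<open>S\<close> on a normed space has the same norm as \<open>S\<close>: the norm
  of operators is submultiplicative, and left multiplication sends the identity, of norm at most
  one, to \<open>S\<close>. Since \<open>M_op \<theta>\<close> is left multiplication by \<open>T_op \<theta>\<close>, everything reduces to the classical
  fact that multiplication by \<open>\<theta>\<close> on \<open>H\<^sup>2\<close> has norm \<open>hinf_norm \<theta>\<close>.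

  That it is at most the supremum norm is the Parseval estimate \<open>mult_coeff_sum_le\<close>. For the lower
  bound, fix \<open>w\<close> in the disc. Evaluation at \<open>w\<close> is a bounded functional on \<open>H\<^sup>2\<close>
  (\<open>norm_h2_fun_le\<close>), and applying the \<open>n\<close>-th power of \<open>T_op \<theta>\<close> to the constant function
  one gives \<open>\<theta> ^ n\<close>. Hence \<open>cmod (\<theta> w) ^ n\<close> is at most a constant, independent of
  \<open>n\<close>, times the \<open>n\<close>-th power of the norm of \<open>T_op \<theta>\<close>, and comparing geometric growth
  rates as \<open>n\<close> tends to infinity removes the constant. Because of this last step, any bound for
  the norm of evaluation at \<open>w\<close>, however crude, leads to the exact inequality.\<close>

lemma norm_bop_apply_le: "norm (bop_apply T x) \<le> norm T * norm x"
  unfolding norm_bop_def by (rule onorm[OF bounded_clinearD(1)[OF bounded_clinear_bop_apply]])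

lemma norm_bop_le:
  "0 \<le> K \<Longrightarrow> (\<And>x. norm (bop_apply T x) \<le> K * norm x) \<Longrightarrow> norm T \<le> K"
  unfolding norm_bop_def by (rule onorm_bound)

lemma norm_bop_compose_le: "norm (S o\<^sub>B T) \<le> norm S * norm T"
proof (rule norm_bop_le)
  fix x
  have "norm (bop_apply S (bop_apply T x)) \<le> norm S * norm (bop_apply T x)"
    by (rule norm_bop_apply_le)
  also have "\<dots> \<le> norm S * (norm T * norm x)"
    by (intro mult_left_mono norm_bop_apply_le norm_ge_zero)
  finally show "norm (bop_apply (S o\<^sub>B T) x) \<le> norm S * norm T * norm x"
    by (simp add: bop_apply_compose mult.assoc)
qed simp

lemma norm_bop_funpow_le: "norm ((bop_apply T ^^ n) x) \<le> norm T ^ n * norm x"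
proof (induction n)
  case (Suc n)
  have "norm ((bop_apply T ^^ Suc n) x) \<le> norm T * norm ((bop_apply T ^^ n) x)"
    by (simp add: norm_bop_apply_le)
  also have "\<dots> \<le> norm T * (norm T ^ n * norm x)"
    by (intro mult_left_mono Suc.IH norm_ge_zero)
  finally show ?case by (simp add: mult.assoc)
qed simp

lemma bounded_clinear_bop_compose_left: "bounded_clinear (\<lambda>T. S o\<^sub>B T)"
  unfolding bounded_clinear_def
proof (intro conjI allI bounded_linear_intro[where K = "norm S"])
  note S = bounded_clinear_bop_apply[of S]
  interpret S: bounded_linear "bop_apply S" by (rule bounded_clinearD(1)[OF S])
  fix T U c r
  show "S o\<^sub>B (T + U) = (S o\<^sub>B T) + (S o\<^sub>B U)" "(S o\<^sub>B (r *\<^sub>R T)) = r *\<^sub>R (S o\<^sub>B T)"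
    "(S o\<^sub>B (c *\<^sub>C T)) = c *\<^sub>C (S o\<^sub>B T)"
    by (rule bop_eqI, simp add: bop_apply_compose bop_apply_ops S.add S.scaleR
        bounded_clinearD(2)[OF S])+
  show "norm (S o\<^sub>B T) \<le> norm T * norm S"
    using norm_bop_compose_le[of S T] by (simp add: mult.commute)
qed

text \<open>The lower bound comes from evaluating at the identity, whose norm is at most one (it is zero
  on the zero space).\<close>

lemma norm_bop_compose_left:
  fixes S :: "'a::complex_normed_vector bop"
  shows "norm (Bop (\<lambda>T. S o\<^sub>B T)) = norm S"
proof (rule antisym)
  let ?L = "Bop (\<lambda>T. S o\<^sub>B T)"
  have L: "bop_apply ?L T = S o\<^sub>B T" for T
    by (simp add: bop_apply_Bop bounded_clinear_bop_compose_left)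
  show "norm ?L \<le> norm S"
    by (rule norm_bop_le) (simp_all add: L norm_bop_compose_le)
  define I :: "'a bop" where "I = Bop (\<lambda>x. x)"
  have I: "bop_apply I x = x" for x
    unfolding I_def by (simp add: bop_apply_Bop bounded_clinear_def bounded_linear_ident)
  have "norm I \<le> 1" by (rule norm_bop_le) (simp_all add: I)
  have "S = bop_apply ?L I"
    by (rule bop_eqI) (simp add: L bop_apply_compose I)
  then have "norm S \<le> norm ?L * norm I"
    using norm_bop_apply_le[of ?L I] by simp
  also have "\<dots> \<le> norm ?L"
    using \<open>norm I \<le> 1\<close> by (intro mult_left_le norm_ge_zero)
  finally show "norm S \<le> norm ?L" .
qed

lemma norm_h2_coeff_le: "cmod (h2_coeff f n) \<le> norm f"
proof (rule power2_le_imp_le)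
  have "(\<Sum>k\<in>{n}. (cmod (h2_coeff f k))\<^sup>2) \<le> (\<Sum>k. (cmod (h2_coeff f k))\<^sup>2)"
    by (intro sum_le_suminf h2_summable) auto
  then show "(cmod (h2_coeff f n))\<^sup>2 \<le> (norm f)\<^sup>2" by (simp add: norm_h2_power2)
qed simp

text \<open>Each Taylor coefficient is at most \<open>norm f\<close> in modulus, so the power series is dominated by
  a geometric series.\<close>

lemma norm_h2_fun_le:
  assumes w: "w \<in> ball 0 1"
  shows "cmod (h2_fun f w) \<le> norm f / (1 - cmod w)"
proof -
  note f = taylor_coeff_sums[OF h2_fun_holomorphic w, of f]
  have "(\<lambda>n. norm f * cmod w ^ n) sums (norm f * (1 / (1 - cmod w)))"
    using w by (intro sums_mult geometric_sums) simp
  then have geo: "(\<lambda>n. norm f * cmod w ^ n) sums (norm f / (1 - cmod w))" by simp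
  have "cmod (\<Sum>n. h2_coeff f n * w ^ n) \<le> (\<Sum>n. norm f * cmod w ^ n)"
    using geo by (intro norm_suminf_le)
      (auto simp: norm_mult norm_power sums_iff intro!: mult_right_mono norm_h2_coeff_le)
  then show ?thesis using f geo by (simp add: sums_iff)
qed

lemma exists_h2_one: "\<exists>e. \<forall>z\<in>ball 0 1. h2_fun e z = 1"
proof -
  define u :: "complex \<Rightarrow> complex" where "u = (\<lambda>z. if z \<in> ball 0 1 then 1 else 0)"
  have ev: "\<forall>\<^sub>F z in nhds 0. u z = 1"
    using eventually_nhds_in_open[of "ball 0 1" "0 :: complex"]
    by (auto simp: u_def elim!: eventually_mono)
  have coeff: "taylor_coeff u n = (if n = 0 then 1 else 0)" for n
    unfolding taylor_coeff_def higher_deriv_cong_ev[OF ev refl] by simp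
  have "u holomorphic_on ball 0 1"
    by (rule holomorphic_transform[OF holomorphic_on_const[of 1]]) (simp add: u_def)
  moreover have "summable (\<lambda>n. (cmod (taylor_coeff u n))\<^sup>2)"
    by (rule summable_finite[of "{0}"]) (auto simp: coeff)
  ultimately have "h2_fun (H2 u) = u"
    by (intro H2_inverse) (auto simp: u_def)
  then show ?thesis
    by (intro exI[of _ "H2 u"]) (simp add: u_def)
qed

text \<open>If \<open>a\<close> were larger than \<open>b\<close>, then the quotient of \<open>a ^ n\<close> by \<open>b ^ n\<close> would be unbounded.\<close>

lemma le_if_powers_le_const_mult:
  fixes a b K :: real
  assumes b: "0 \<le> b" and le: "\<And>n. a ^ n \<le> K * b ^ n"
  shows "a \<le> b"
proof (rule ccontr)
  assume "\<not> a \<le> b"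
  then have ab: "b < a" by simp
  show False
  proof (cases "b = 0")
    case True
    with ab le[of 1] show False by simp
  next
    case False
    with b have b: "0 < b" by simp
    obtain n where n: "K < (a / b) ^ n"
      using real_arch_pow[of "a / b" K] ab b by auto
    with le[of n] b show False by (simp add: power_divide field_simps)
  qed
qed

lemma h2_fun_T_op_funpow:
  "\<theta> \<in> Hinf \<Longrightarrow> h2_fun ((bop_apply (T_op \<theta>) ^^ n) f) z = \<theta> z ^ n * h2_fun f z"
  by (induction n) (simp_all add: h2_fun_T_op)

lemma bdd_above_cmod_Hinf:
  assumes "\<theta> \<in> Hinf"
  shows "bdd_above ((\<lambda>z. cmod (\<theta> z)) ` ball 0 1)"
  using assms unfolding Hinf_def bounded_iff by (auto intro: bdd_aboveI2)

lemma cmod_le_norm_T_op: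
  assumes \<theta>: "\<theta> \<in> Hinf" and w: "w \<in> ball 0 1"
  shows "cmod (\<theta> w) \<le> norm (T_op \<theta>)"
proof -
  obtain e where e: "\<forall>z\<in>ball 0 1. h2_fun e z = 1" using exists_h2_one by blast
  have "cmod (\<theta> w) ^ n \<le> norm e / (1 - cmod w) * norm (T_op \<theta>) ^ n" for n
  proof -
    let ?g = "(bop_apply (T_op \<theta>) ^^ n) e"
    have "cmod (\<theta> w) ^ n = cmod (h2_fun ?g w)"
      using w e by (simp add: h2_fun_T_op_funpow[OF \<theta>] norm_power)
    also have "\<dots> \<le> norm ?g / (1 - cmod w)" by (rule norm_h2_fun_le[OF w])
    also have "\<dots> \<le> norm (T_op \<theta>) ^ n * norm e / (1 - cmod w)"
      using w by (intro divide_right_mono norm_bop_funpow_le) simp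
    finally show ?thesis by (simp add: mult.commute)
  qed
  then show ?thesis by (rule le_if_powers_le_const_mult[OF norm_ge_zero])
qed

lemma norm_T_op:
  assumes \<theta>: "\<theta> \<in> Hinf"
  shows "norm (T_op \<theta>) = hinf_norm \<theta>"
proof (rule antisym)
  have C: "cmod (\<theta> z) \<le> hinf_norm \<theta>" if "z \<in> ball 0 1" for z
    unfolding hinf_norm_def using bdd_above_cmod_Hinf[OF \<theta>] that by (rule cSUP_upper2) simp
  have C0: "0 \<le> hinf_norm \<theta>" using order_trans[OF norm_ge_zero C[of 0]] by simp
  show "norm (T_op \<theta>) \<le> hinf_norm \<theta>"
  proof (rule norm_bop_le[OF C0], rule power2_le_imp_le)
    fix f
    let ?g = "bop_apply (T_op \<theta>) f"
    have g: "h2_fun ?g = (\<lambda>z. \<theta> z * h2_fun f z)" by (rule ext) (rule h2_fun_T_op[OF \<theta>])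
    have "\<theta> holomorphic_on ball 0 1" using \<theta> by (simp add: Hinf_def)
    then show "(norm ?g)\<^sup>2 \<le> (hinf_norm \<theta> * norm f)\<^sup>2"
      unfolding norm_h2_power2[of ?g]
      by (intro suminf_le_const h2_summable, unfold g) (rule mult_coeff_sum_le[OF _ C])
    show "0 \<le> hinf_norm \<theta> * norm f" using C0 by simp
  qed
  show "hinf_norm \<theta> \<le> norm (T_op \<theta>)"
    unfolding hinf_norm_def by (rule cSUP_least) (auto intro: cmod_le_norm_T_op[OF \<theta>])
qed

theorem lemma2p5:
  fixes \<theta> :: "complex \<Rightarrow> complex"
  assumes "\<theta> \<in> Hinf"
  shows "bounded_clinear (M_op \<theta>) \<and> norm (Bop (M_op \<theta>)) = hinf_norm \<theta>"
proof -
  have "M_op \<theta> = (\<lambda>T. T_op \<theta> o\<^sub>B T)" by (simp add: fun_eq_iff M_op_def)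
  then show ?thesis
    by (simp add: bounded_clinear_bop_compose_left norm_bop_compose_left norm_T_op[OF assms])
qed

end
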